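(* Let $t^*$ be the time left in the masked diffusion reverse process with schedule $\alpha_t$ (i.e. the value of the time variable $t\in[0,1]$, which runs from $1$ down to $0$) when a token transitions to a non-mask state. Then $$P(t^*\le t)=1-\alpha_t .$$
   Context: A noise schedule is a strictly decreasing function $t\mapsto\alpha_t\in[0,1]$ of $t\in[0,1]$ with $\alpha_0\approx1$ and $\alpha_1\approx0$. A token takes values in a discrete set, and $\mathbf m$ is a special additional mask state. The reverse process $(\mathbf{x}_t)$ of a single token runs with $t$ decreasing from $1$ to $0$, starting from the mask state. For $s<t$: if $\mathbf{x}_t\neq\mathbf m$ then $\mathbf{x}_s=\mathbf{x}_t$ (once unmasked, the token remains unchanged until $t=0$); if $\mathbf{x}_t=\mathbf m$, then $\mathbf{x}_s$ is in a non-mask state with probability $\frac{\alpha_s-\alpha_t}{1-\alpha_t}$ and stays masked with probability $\frac{1-\alpha_s}{1-\alpha_t}$. The non-mask value taken (the clean token when conditioning on it, or a token drawn from a model's prediction) does not affect these probabilities.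
   Formalization: The schedule is assumed to satisfy α_1 = 0 exactly (not just α_1 ≈ 0) and to be right-continuous on [0,1), without which the equality fails at t = 1 or at a jump; a token that never unmasks is given t* = 0. *)

theory Defs
  imports "HOL-Probability.Probability"
begin

text \<open>
  Only the exact part of the notion is recorded here. The informal endpoint conditions
  \<open>\<alpha> 0 \<approx> 1\<close> and \<open>\<alpha> 1 \<approx> 0\<close> have no exact content of their own; where an exact version
  is needed it is stated as an explicit hypothesis.
\<close>

locale noise_schedule =
  fixes \<alpha> :: "real \<Rightarrow> real"
  assumes schedule_range: "\<And>t. t \<in> {0..1} \<Longrightarrow> \<alpha> t \<in> {0..1}"
    and schedule_decreasing: "strict_antimono_on {0..1} \<alpha>"

text \<open>
  A state is an element of \<open>'v option\<close>: \<open>None\<close> is the mask \<open>m\<close> and \<open>Some v\<close> is the token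
  value \<open>v\<close>. Only times in \<open>{0..1}\<close> matter, and the process runs from time 1 down to time 0, so
  for \<open>s < t\<close> the state \<open>x s\<close> is the later one. No law is imposed on the value taken when the
  token is unmasked.
\<close>

locale masked_reverse_process = prob_space M + noise_schedule \<alpha>
  for M :: "'w measure" and \<alpha> :: "real \<Rightarrow> real" +
  fixes x :: "real \<Rightarrow> 'w \<Rightarrow> 'v option"
  assumes state_measurable: "\<And>t. t \<in> {0..1} \<Longrightarrow> x t \<in> measurable M (count_space UNIV)"
    and starts_masked: "\<And>\<omega>. \<omega> \<in> space M \<Longrightarrow> x 1 \<omega> = None"
    and unmasked_unchanged: "\<And>s t \<omega>. \<lbrakk>s \<in> {0..1}; t \<in> {0..1}; s < t; \<omega> \<in> space M; x t \<omega> \<noteq> None\<rbrakk>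
          \<Longrightarrow> x s \<omega> = x t \<omega>"
    and prob_unmask: "\<And>s t. \<lbrakk>s \<in> {0..1}; t \<in> {0..1}; s < t\<rbrakk>
          \<Longrightarrow> \<P>(\<omega> in M. x s \<omega> \<noteq> None \<bar> x t \<omega> = None) = (\<alpha> s - \<alpha> t) / (1 - \<alpha> t)"
    and prob_stay_masked: "\<And>s t. \<lbrakk>s \<in> {0..1}; t \<in> {0..1}; s < t\<rbrakk>
          \<Longrightarrow> \<P>(\<omega> in M. x s \<omega> = None \<bar> x t \<omega> = None) = (1 - \<alpha> s) / (1 - \<alpha> t)"

text \<open>
  Time runs downwards, so the moment of unmasking is the supremum of the unmasked times. All
  these times are nonnegative, hence inserting 0 has an effect only on a path that never leaves
  the mask state (possible only if \<open>\<alpha> 0 < 1\<close>): it gets the terminal time 0.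
\<close>

definition unmask_time :: "(real \<Rightarrow> 'w \<Rightarrow> 'v option) \<Rightarrow> 'w \<Rightarrow> real" where
  "unmask_time x \<omega> = Sup (insert 0 {t \<in> {0..1}. x t \<omega> \<noteq> None})"

lemma unmask_time_le_iff:
  "unmask_time x \<omega> \<le> c \<longleftrightarrow> 0 \<le> c \<and> (\<forall>t\<in>{0..1}. x t \<omega> \<noteq> None \<longrightarrow> t \<le> c)"
proof -
  have "bdd_above (insert 0 {t \<in> {0..1::real}. x t \<omega> \<noteq> None})"
    by (rule bdd_aboveI[of _ 1]) auto
  then show ?thesis
    unfolding unmask_time_def by (subst cSup_le_iff) auto
qed

text \<open>In particular the events \<open>unmask_time x \<omega> \<le> t\<close> are measurable.\<close>

lemma (in masked_reverse_process) unmask_time_measurable: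
  "unmask_time x \<in> borel_measurable M"
proof (rule borel_measurableI_le)
  fix c :: real
  let ?Q = "{r :: rat. (of_rat r :: real) \<in> {0..1} \<and> c < of_rat r}"
  have eq: "{\<omega> \<in> space M. unmask_time x \<omega> \<le> c} =
      {\<omega> \<in> space M. 0 \<le> c \<and> (\<forall>r\<in>?Q. x (of_rat r) \<omega> = None)}" (is "?L = ?R")
  proof (intro set_eqI iffI)
    fix \<omega> assume "\<omega> \<in> ?L"
    then show "\<omega> \<in> ?R" by (force simp: unmask_time_le_iff)
  next
    fix \<omega> assume R: "\<omega> \<in> ?R"
    have "t \<le> c" if t: "t \<in> {0..1}" "x t \<omega> \<noteq> None" for t
    proof (rule ccontr)
      assume "\<not> t \<le> c"
      then obtain q where q: "c < of_rat q" "of_rat q < t"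
        using of_rat_dense[of c t] by auto
      moreover from q t R have q01: "(of_rat q :: real) \<in> {0..1}"
        unfolding atLeastAtMost_iff mem_Collect_eq by linarith
      ultimately have "x (of_rat q) \<omega> = x t \<omega>"
        using t R by (intro unmasked_unchanged) auto
      moreover have "x (of_rat q) \<omega> = None"
        using R q01 q(1) by auto
      ultimately show False using t by simp
    qed
    then show "\<omega> \<in> ?L" using R by (auto simp: unmask_time_le_iff)
  qed
  have masked: "Measurable.pred M (\<lambda>\<omega>. x q \<omega> = None)" if "q \<in> {0..1}" for q
    using measurable_compose[OF state_measurable[OF that], of "\<lambda>y. y = None"] by simp
  have [measurable]: "Measurable.pred M (\<lambda>\<omega>. \<forall>r\<in>?Q. x (of_rat r) \<omega> = None)"
    by (rule pred_intros_countable_bounded(3)) (rule masked, simp)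
  have "?R \<in> sets M" by measurable
  then show "{\<omega> \<in> space M. unmask_time x \<omega> \<le> c} \<in> sets M"
    by (simp only: eq)
qed

end

theory Submission
  imports Defs "HOL-Real_Asymp.Real_Asymp"
begin

text \<open>
  Since the token is surely masked at time 1, where \<open>\<alpha>\<close> vanishes, it is still masked at time \<open>s\<close>
  with probability \<open>1 - \<alpha> s\<close>. The event \<open>t\<^sup>* \<le> t\<close> says that the token is masked at all
  times after \<open>t\<close>, not at \<open>t\<close> itself; it is the decreasing limit of the events ``masked at time
  \<open>u n\<close>'' along a sequence \<open>u n\<close> decreasing to \<open>t\<close>, and right continuity of \<open>\<alpha>\<close> identifies
  the limit of their probabilities.
\<close>

context masked_reverse_process
begin

lemma masked_measurable [measurable]:
  "s \<in> {0..1} \<Longrightarrow> Measurable.pred M (\<lambda>\<omega>. x s \<omega> = None)"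
  using measurable_compose[OF state_measurable, of s "\<lambda>y. y = None"] by simp

text \<open>Contrapositive of \<open>unmasked_unchanged\<close>: a value present at \<open>t\<close>
  would persist down to \<open>s\<close>.\<close>

lemma masked_mono:
  assumes "s \<in> {0..1}" "t \<in> {0..1}" "s \<le> t" "\<omega> \<in> space M" "x s \<omega> = None"
  shows "x t \<omega> = None"
  using unmasked_unchanged[of s t \<omega>] assms by (cases "s = t"; cases "x t \<omega>") auto

lemma prob_masked:
  assumes "\<alpha> 1 = 0" "s \<in> {0..1}"
  shows "\<P>(\<omega> in M. x s \<omega> = None) = 1 - \<alpha> s"
proof (cases "s = 1")
  case True
  then show ?thesis
    using assms starts_masked by (simp add: prob_space cong: conj_cong)
next
  case False
  \<comment> \<open>Conditioning on the sure event \<open>x 1 \<omega> = None\<close> changes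
    nothing; \<open>prob_stay_masked\<close> then applies since \<open>s < 1\<close>, with
    denominator 1.\<close>
  have "\<P>(\<omega> in M. x s \<omega> = None) = \<P>(\<omega> in M. x s \<omega> = None \<bar> x 1 \<omega> = None)"
    unfolding cond_prob_def using starts_masked by (simp add: prob_space cong: conj_cong)
  also have "\<dots> = 1 - \<alpha> s"
    using prob_stay_masked[of s 1] assms False by simp
  finally show ?thesis .
qed

lemma prob_unmask_time_le:
  assumes "\<alpha> 1 = 0" and t: "t \<in> {0..<1}" and cont: "continuous (at_right t) \<alpha>"
  shows "\<P>(\<omega> in M. unmask_time x \<omega> \<le> t) = 1 - \<alpha> t"
proof -
  \<comment> \<open>The offset 2 keeps \<open>u n\<close> strictly below 1 even at
    \<open>n = 0\<close>.\<close>
  define u where "u n = t + (1 - t) / real (n + 2)" for n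
  have u: "decseq u" "\<And>n. t < u n"
    using t by (auto simp: u_def decseq_def intro!: divide_left_mono)
  have u_less: "u n < 1" for n
  proof -
    have "(1 - t) / real (n + 2) < (1 - t) / 1"
      using t by (intro divide_strict_left_mono) auto
    then show ?thesis
      by (simp add: u_def)
  qed
  have u_lim: "u \<longlonglongrightarrow> t"
    unfolding u_def by real_asymp
  define A where "A n = {\<omega> \<in> space M. x (u n) \<omega> = None}" for n
  have u01: "u n \<in> {0..1}" for n
    using u(2)[of n] u_less[of n] t by auto
  have "{\<omega> \<in> space M. unmask_time x \<omega> \<le> t} = (\<Inter>n. A n)"
  proof (intro set_eqI iffI)
    fix \<omega> assume \<omega>: "\<omega> \<in> {\<omega> \<in> space M. unmask_time x \<omega> \<le> t}"
    then have "\<forall>r\<in>{0..1}. x r \<omega> \<noteq> None \<longrightarrow> r \<le> t"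
      by (simp add: unmask_time_le_iff)
    then have "x (u n) \<omega> = None" for n
      using u(2)[of n] u01[of n] not_le by blast
    then show "\<omega> \<in> (\<Inter>n. A n)"
      using \<omega> by (simp add: A_def)
  next
    fix \<omega> assume \<omega>: "\<omega> \<in> (\<Inter>n. A n)"
    have "r \<le> t" if r: "r \<in> {0..1}" "x r \<omega> \<noteq> None" for r
    proof (rule ccontr)
      assume "\<not> r \<le> t"
      \<comment> \<open>An unmasked time \<open>r > t\<close> has some \<open>u n\<close> below it;
        being masked at \<open>u n\<close> forces being masked at \<open>r\<close>.\<close>
      then have "eventually (\<lambda>n. u n < r) sequentially"
        using u_lim by (intro order_tendstoD) auto
      then obtain n where "u n < r"
        by (auto simp: eventually_sequentially)
      then show False
        using \<omega> r u01 masked_mono[of "u n" r \<omega>] by (auto simp: A_def)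
    qed
    then show "\<omega> \<in> {\<omega> \<in> space M. unmask_time x \<omega> \<le> t}"
      using \<omega> t by (auto simp: A_def unmask_time_le_iff)
  qed
  \<comment> \<open>Continuity from above; the events decrease because \<open>u\<close> does and
    masking passes to larger times.\<close>
  moreover have "(\<lambda>n. prob (A n)) \<longlonglongrightarrow> prob (\<Inter>n. A n)"
  proof (rule finite_Lim_measure_decseq)
    show "range A \<subseteq> events"
      using u01 by (auto simp: A_def)
    show "decseq A"
      unfolding decseq_def A_def
      using masked_mono u01 decseqD[OF u(1)] by blast
  qed
  moreover have "(\<lambda>n. prob (A n)) \<longlonglongrightarrow> 1 - \<alpha> t"
  proof -
    \<comment> \<open>The strict inequality \<open>t < u n\<close> places the sequence in the
      punctured right neighbourhood of \<open>t\<close>.\<close>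
    have "filterlim u (at_right t) sequentially"
      using u(2) u_lim by (auto simp: filterlim_at less_imp_neq[THEN not_sym])
    then have "(\<lambda>n. \<alpha> (u n)) \<longlonglongrightarrow> \<alpha> t"
      using cont by (auto simp: continuous_within intro: filterlim_compose)
    then show ?thesis
      unfolding A_def prob_masked[OF assms(1) u01] by (intro tendsto_intros)
  qed
  ultimately show ?thesis
    using LIMSEQ_unique by metis
qed

end

theorem proposition3p2:
  fixes M :: "'w measure" and \<alpha> :: "real \<Rightarrow> real"
    and x :: "real \<Rightarrow> 'w \<Rightarrow> 'v option" and t :: real
  assumes process: "masked_reverse_process M \<alpha> x"
    and alpha_one: "\<alpha> 1 = 0"
    and right_continuous: "\<And>u. u \<in> {0..<1} \<Longrightarrow> continuous (at_right u) \<alpha>"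
    and t: "t \<in> {0..1}"
  shows "\<P>(\<omega> in M. unmask_time x \<omega> \<le> t) = 1 - \<alpha> t"
proof -
  interpret masked_reverse_process M \<alpha> x by (rule process)
  show ?thesis
  \<comment> \<open>At \<open>t = 1\<close> no later times remain to approximate from; the event is
    the whole space.\<close>
  proof (cases "t = 1")
    case True
    then show ?thesis
      using alpha_one by (simp add: unmask_time_le_iff prob_space)
  next
    case False
    with t show ?thesis
      using alpha_one right_continuous by (intro prob_unmask_time_le) auto
  qed
qed

end
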